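(* Let $n\in\mathbb{N}$, $\overline N := n(n+1)/2$, $C\in\mathbb{S}^n$, $b\in\mathbb{R}$, let $\mathcal{A}\subset\mathbb{S}^n$ be compact with nonempty interior, and let $K\subset\mathbb{R}^n$ be the closed Euclidean unit ball. Assume that the admissible set $\{X\in\mathbb{S}^n : X\succeq 0,\ \langle A,X\rangle\le b \text{ for all } A\in\mathcal{A}\}$ has nonempty interior, i.e., there exists $\overline X\in\mathbb{S}^n$ with $\overline X\succeq 0$ and $\langle A,\overline X\rangle<b$ for every $A\in\mathcal{A}$. Consider the semi-infinite semi-definite program with value $$\overline y^{\ast}=\inf\Big\{\sum_{i=1}^n C_i^{\top}X_i \ :\ X=(X_1\,\cdots\,X_n)\in\mathbb{S}^n,\ \sum_{i=1}^n A_i^{\top}X_i\le b\ \text{ for all } A=(A_1\,\cdots\,A_n)\in\mathcal{A},\ v^{\top}Xv\ge 0\ \text{ for all } v\in K\Big\}.$$ For $\overline d=(d_1,\ldots,d_{\overline N})\in\mathcal{D}:=(\mathcal{A}\times K)^{\overline N}$ with $d_j=(A^j,v_j)$, let $\mathcal{R}(\overline d)$ be the relaxed feasible set and $G(\overline d)$ the relaxed value, as defined in the context. Suppose that the following Slater-type condition holds: there exists an $\overline N$-tuple $(d_1,\ldots,d_{\overline N})\in\mathcal{D}$ such that $\mathcal{R}(d_1,\ldots,d_{\overline N})$ is nonempty. Consider the global maximization problem $$\sup_{\overline d\in\mathcal{D}} G(\overline d).$$ Then there exists $\overline d^{\ast}\in\mathcal{D}$ that solves this maximization problem. Moreover, $\overline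 y^{\ast}=G(\overline d^{\ast})$.
   Context: $\mathbb{S}^n$ is the vector space of real symmetric $n\times n$ matrices with inner product $\langle A,B\rangle=\operatorname{tr}(A^{\top}B)$; $X\succeq 0$ means $X$ is positive semi-definite. For a matrix $X$, $X_1,\ldots,X_n\in\mathbb{R}^n$ denote its columns (likewise $C_i$, $A_i$), so $\sum_{i=1}^n C_i^{\top}X_i=\langle C,X\rangle$. The number $\overline N=n(n+1)/2$ is the dimension of the decision space $\mathbb{S}^n$. The optimal value $\overline y^{\ast}$ is allowed to be $-\infty$. Relaxed feasible set: for $\overline d=(d_1,\ldots,d_{\overline N})\in\mathcal{D}=(\mathcal{A}\times K)^{\overline N}$, where $d_j=(A^j,v_j)$ and $A^j=(A^j_1\,\cdots\,A^j_n)$, $$\mathcal{R}(\overline d):=\Big\{X=(X_1\,\cdots\,X_n)\in\mathbb{S}^n:\ \sum_{i=1}^n (A^j_i)^{\top}X_i\le b\ \text{ and }\ v_j^{\top}Xv_j\ge 0\ \text{ for } j=1,\ldots,\overline N\Big\}.$$ Relaxed value function: $$G(\overline d):=\inf\Big\{\sum_{i=1}^n C_i^{\top}X_i:\ X\in\mathcal{R}(\overline d)\Big\},$$ where the infimum is allowed to be $-\infty$. *)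

theory Defs
  imports "HOL-Analysis.Analysis"
begin

definition Sym :: "(real^'n^'n) set" where
  "Sym = {X. transpose X = X}"

definition trace_inner :: "real^'n^'n \<Rightarrow> real^'n^'n \<Rightarrow> real" where
  "trace_inner A B = trace (transpose A ** B)"

definition psd :: "real^'n^'n \<Rightarrow> bool" where
  "psd X \<longleftrightarrow> X \<in> Sym \<and> (\<forall>v. v \<bullet> (X *v v) \<ge> 0)"

definition col_sum :: "real^'n^'n \<Rightarrow> real^'n^'n \<Rightarrow> real" where
  "col_sum A X = (\<Sum>i\<in>UNIV. column i A \<bullet> column i X)"

text \<open>The library inner product on matrices is the trace inner product, so the topology
  used on the symmetric matrices is the one induced by it.\<close>

lemma col_sum_eq_trace_inner: "col_sum A X = trace_inner A X"
  by (simp add: col_sum_def trace_inner_def trace_def matrix_matrix_mult_def transpose_def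
      column_def inner_vec_def)

lemma inner_eq_trace_inner: "A \<bullet> X = trace_inner A X"
  unfolding trace_inner_def trace_def matrix_matrix_mult_def transpose_def inner_vec_def
  by (simp, rule sum.swap)

definition feasible :: "real \<Rightarrow> (real^'n^'n) set \<Rightarrow> (real^'n) set \<Rightarrow> (real^'n^'n) set" where
  "feasible b \<A> K =
     {X \<in> Sym. (\<forall>A\<in>\<A>. col_sum A X \<le> b) \<and> (\<forall>v\<in>K. v \<bullet> (X *v v) \<ge> 0)}"

text \<open>Values are extended reals: they may be \<open>-\<infinity>\<close>, and the infimum over an empty
  feasible set is \<open>\<infinity>\<close>.\<close>

definition opt_value ::
    "real^'n^'n \<Rightarrow> real \<Rightarrow> (real^'n^'n) set \<Rightarrow> (real^'n) set \<Rightarrow> ereal" where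
  "opt_value C b \<A> K = (INF X\<in>feasible b \<A> K. ereal (col_sum C X))"

definition dim_sym :: "'n::finite itself \<Rightarrow> nat" where
  "dim_sym _ = CARD('n) * (CARD('n) + 1) div 2"

text \<open>An \<open>N\<close>-tuple of pairs is an extensional function on \<open>{1..N}\<close>.\<close>

definition tuples ::
    "(real^'n^'n) set \<Rightarrow> (real^'n) set \<Rightarrow> (nat \<Rightarrow> (real^'n^'n) \<times> (real^'n)) set" where
  "tuples \<A> K = ({1..dim_sym TYPE('n)} \<rightarrow>\<^sub>E \<A> \<times> K)"

definition relaxed ::
    "real \<Rightarrow> (nat \<Rightarrow> (real^'n^'n) \<times> (real^'n)) \<Rightarrow> (real^'n^'n) set" where
  "relaxed b d =
     {X \<in> Sym. \<forall>j\<in>{1..dim_sym TYPE('n)}.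
        col_sum (fst (d j)) X \<le> b \<and> snd (d j) \<bullet> (X *v snd (d j)) \<ge> 0}"

definition relaxed_value ::
    "real^'n^'n \<Rightarrow> real \<Rightarrow> (nat \<Rightarrow> (real^'n^'n) \<times> (real^'n)) \<Rightarrow> ereal" where
  "relaxed_value C b d = (INF X\<in>relaxed b d. ereal (col_sum C X))"

end

theory Submission
  imports Defs
begin

text \<open>
  Every relaxed feasible set contains the feasible set, so every relaxed value is at most the
  optimal value, and the whole content is that some tuple attains this bound. If the optimal
  value is \<open>-\<infinity>\<close>, any tuple does. Otherwise it is a real \<open>y\<close>, and \<open>y \<le> C \<bullet> X\<close> is a linear
  inequality implied by infinitely many linear inequalities in \<open>X\<close>: \<open>A \<bullet> X \<le> b\<close> for \<open>A \<in> \<A>\<close>, and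
  \<open>0 \<le> vv\<^sup>T \<bullet> X\<close> for unit vectors \<open>v\<close>. It has to be deduced from at most \<open>N = n (n + 1) / 2\<close> of them.

  The Slater condition makes this possible without duality theory for cones. Adding a small
  multiple of the identity to the given matrix yields a positive definite \<open>Z\<close> with
  \<open>A \<bullet> Z < b\<close> throughout \<open>\<A>\<close>
  (\<open>positive_definite_slater_point\<close>), at which each of the inequalities above is strict. Substituting
  \<open>X = Z + Y\<close> and dividing each inequality by its positive slack at \<open>Z\<close> turns the system into
  \<open>s \<bullet> Y \<le> 1\<close> for \<open>s\<close> in a compact set \<open>S\<close> of symmetric matrices, and the implied
  inequality into \<open>- C \<bullet> Y \<le> \<rho>\<close> with \<open>\<rho> = C \<bullet> Z - y\<close>. When \<open>\<rho> > 0\<close>, the bipolar theorem places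
  \<open>- C / \<rho>\<close> in the convex hull of \<open>S \<union> {0}\<close>. A version of Caratheodory's theorem in which the weights
  need only have sum at most \<open>1\<close> then writes \<open>- C / \<rho>\<close> with linearly independent elements of \<open>S\<close>
  (\<open>convex_hull_insert_0_independent\<close>), hence with at most \<open>dim Sym\<close> of
  them, where the affine version would give \<open>dim Sym + 1\<close>. These elements already imply the inequality
  (\<open>finite_subsystem\<close>). When \<open>\<rho> = 0\<close>, the matrix \<open>C\<close> vanishes and
  none are needed. Since \<open>dim Sym \<le> N\<close> (\<open>dim_Sym_le\<close>), each of them can be given its own entry of
  the tuple: either as the matrix or as the vector of the pair, the other component
  being arbitrary.
\<close>

section \<open>Finite subsystems of a normalised linear system\<close>

text \<open>
  Because \<open>0\<close> may take up the remaining weight, the weights on \<open>S\<close> need only sum to at most \<open>1\<close>.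
  This is an inequality and not an equation, so an arbitrary linear dependence, with its sign chosen
  so that the sum does not grow, suffices to eliminate a point; Caratheodory's theorem for convex
  combinations would require an affine one. A representation with as few points as possible is
  therefore linearly independent.
\<close>

lemma convex_hull_insert_0_independent:
  fixes S :: "'a::euclidean_space set"
  assumes "c \<in> convex hull (insert 0 S)"
  obtains F u where "finite F" "F \<subseteq> S" "independent F"
    "\<And>p. p \<in> F \<Longrightarrow> 0 \<le> u p" "sum u F \<le> 1" "(\<Sum>p\<in>F. u p *\<^sub>R p) = c"
proof -
  define P where "P F u \<longleftrightarrow> finite F \<and> F \<subseteq> S \<and> (\<forall>p\<in>F. (0::real) \<le> u p) \<and> sum u F \<le> 1
    \<and> (\<Sum>p\<in>F. u p *\<^sub>R p) = c" for F u
  from assms obtain T u where T: "finite T" "T \<subseteq> insert 0 S" "\<forall>p\<in>T. 0 \<le> u p" "sum u T = 1"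
      "(\<Sum>p\<in>T. u p *\<^sub>R p) = c"
    by (auto simp: convex_hull_explicit)
  have "P (T - {0}) u"
  proof -
    have "sum u (T - {0}) \<le> sum u T"
      using T by (intro sum_mono2) auto
    moreover have "(\<Sum>p\<in>T - {0}. u p *\<^sub>R p) = (\<Sum>p\<in>T. u p *\<^sub>R p)"
      using T by (intro sum.mono_neutral_left) auto
    ultimately show ?thesis
      using T by (auto simp: P_def)
  qed
  then obtain F where ex: "\<exists>u. P F u" and least: "\<And>G w. P G w \<Longrightarrow> card F \<le> card G"
    using ex_has_least_nat[of "\<lambda>F. \<exists>u. P F u" "T - {0}" card] by blast
  then obtain u where F: "P F u"
    by blast
  have "independent F"
  proof
    assume "dependent F"
    then obtain a0 where a0: "\<exists>p\<in>F. a0 p \<noteq> 0" "(\<Sum>p\<in>F. a0 p *\<^sub>R p) = 0"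
      using F by (auto simp: dependent_finite P_def)
    \<comment> \<open>Orient the dependence so that moving against it does not increase the total weight.\<close>
    define a where "a = (if sum a0 F \<ge> 0 then a0 else (\<lambda>p. - a0 p))"
    have a: "\<exists>p\<in>F. a p \<noteq> 0" "(\<Sum>p\<in>F. a p *\<^sub>R p) = 0" "sum a F \<ge> 0"
      using a0 by (auto simp: a_def sum_negf)
    have fin: "finite F"
      using F by (simp add: P_def)
    have "\<exists>p\<in>F. a p > 0"
    proof (rule ccontr)
      assume "\<not> ?thesis"
      then have neg: "\<And>p. p \<in> F \<Longrightarrow> a p \<le> 0"
        by force
      then have "sum a F = 0"
        using a(3) sum_nonpos[of F a] by (meson antisym)
      then show False
        using a(1) neg fin sum_nonneg_eq_0_iff[of F "\<lambda>p. - a p"] by (auto simp: sum_negf)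
    qed
    \<comment> \<open>The largest multiple of the dependence that can be subtracted keeps all weights nonnegative
      and makes the weight of \<open>q\<close> vanish.\<close>
    define W where "W = {p\<in>F. a p > 0}"
    have W: "finite W" "W \<noteq> {}"
      using fin \<open>\<exists>p\<in>F. a p > 0\<close> by (auto simp: W_def)
    define q where "q = arg_min_on (\<lambda>p. u p / a p) W"
    define t where "t = u q / a q"
    have q: "q \<in> W" "\<And>p. p \<in> W \<Longrightarrow> t \<le> u p / a p"
      using arg_min_if_finite(1)[OF W] arg_min_least[OF W] by (auto simp: q_def t_def)
    have qF: "q \<in> F" "a q > 0" "t \<ge> 0"
      using q(1) F by (auto simp: W_def t_def P_def)
    define w where "w p = u p - t * a p" for p
    have wq: "w q = 0"
      using qF by (simp add: w_def t_def)
    have "w p \<ge> 0" if "p \<in> F" for p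
    proof (cases "a p > 0")
      case True
      then show ?thesis
        using q(2)[of p] that by (simp add: W_def w_def field_simps)
    next
      case False
      then have "t * a p \<le> 0"
        using qF by (simp add: mult_nonneg_nonpos)
      moreover have "u p \<ge> 0"
        using F that by (simp add: P_def)
      ultimately show ?thesis
        by (simp add: w_def)
    qed
    moreover have "sum w (F - {q}) \<le> 1"
    proof -
      have "sum w (F - {q}) = sum w F"
        using fin wq qF by (simp add: sum_diff1)
      also have "\<dots> = sum u F - t * sum a F"
        by (simp add: w_def sum_subtractf sum_distrib_left)
      also have "\<dots> \<le> sum u F"
        using qF a(3) by simp
      finally show ?thesis
        using F by (simp add: P_def)
    qed
    moreover have "(\<Sum>p\<in>F - {q}. w p *\<^sub>R p) = c"
    proof -
      have "(\<Sum>p\<in>F - {q}. w p *\<^sub>R p) = (\<Sum>p\<in>F. w p *\<^sub>R p)"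
        using fin wq qF by (simp add: sum_diff1)
      also have "\<dots> = (\<Sum>p\<in>F. u p *\<^sub>R p) - t *\<^sub>R (\<Sum>p\<in>F. a p *\<^sub>R p)"
        by (simp add: w_def sum_subtractf scaleR_sum_right scaleR_left_diff_distrib)
      finally show ?thesis
        using a(2) F by (simp add: P_def)
    qed
    ultimately have "P (F - {q}) w"
      using F by (auto simp: P_def)
    moreover have "card (F - {q}) < card F"
      using fin qF(1) by (rule card_Diff1_less)
    ultimately show False
      using least[of "F - {q}" w] by simp
  qed
  with F that show thesis
    by (auto simp: P_def)
qed

text \<open>
  A quantitative bipolar theorem relative to a subspace. For \<open>\<rho> > 0\<close> a hyperplane separating \<open>c / \<rho>\<close>
  from the hull of \<open>S \<union> {0}\<close> would, after projection to \<open>V\<close> and scaling, be a solution of the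
  system that violates the implied inequality. For \<open>\<rho> = 0\<close> this scaling is not available, but then
  \<open>c = 0\<close>, as the boundedness of \<open>S\<close> lets a small multiple of \<open>c\<close> solve the system.
\<close>

lemma finite_subsystem:
  fixes S V :: "'a::euclidean_space set"
  assumes V: "subspace V" and S: "compact S" "S \<subseteq> V" and c: "c \<in> V" and \<rho>: "0 \<le> \<rho>"
    and implied: "\<And>y. \<lbrakk>y \<in> V; \<forall>s\<in>S. s \<bullet> y \<le> 1\<rbrakk> \<Longrightarrow> c \<bullet> y \<le> \<rho>"
  obtains F where "finite F" "F \<subseteq> S" "card F \<le> dim V"
    "\<And>y. \<forall>p\<in>F. p \<bullet> y \<le> 1 \<Longrightarrow> c \<bullet> y \<le> \<rho>"
proof (cases "\<rho> = 0")
  case True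
  obtain B where B: "B > 0" "\<And>s. s \<in> S \<Longrightarrow> norm s \<le> B"
    using compact_imp_bounded[OF S(1)] unfolding bounded_pos by blast
  define e where "e = 1 / (B * (norm c + 1))"
  have e: "e > 0"
    using B by (simp add: e_def add_nonneg_pos)
  have "s \<bullet> (e *\<^sub>R c) \<le> 1" if "s \<in> S" for s
  proof -
    have "s \<bullet> c \<le> norm s * norm c"
      by (rule norm_cauchy_schwarz)
    also have "\<dots> \<le> B * (norm c + 1)"
      using B that by (intro mult_mono) auto
    finally show ?thesis
      using e by (simp add: e_def pos_divide_le_eq)
  qed
  then have "c \<bullet> (e *\<^sub>R c) \<le> 0"
    using implied[of "e *\<^sub>R c"] V c True by (simp add: subspace_scale)
  then have "c \<bullet> c \<le> 0"
    using e by (simp add: mult_le_0_iff)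
  then have "c = 0"
    by (metis inner_eq_zero_iff inner_ge_zero order_antisym)
  then show thesis
    by (intro that[of "{}"]) (auto simp: True)
next
  case False
  with \<rho> have pos: "\<rho> > 0"
    by linarith
  let ?H = "convex hull (insert 0 S)"
  have "c /\<^sub>R \<rho> \<in> ?H"
  proof (rule ccontr)
    assume "c /\<^sub>R \<rho> \<notin> ?H"
    moreover have "closed ?H"
      using S(1) by (intro compact_imp_closed compact_convex_hull compact_insert)
    ultimately obtain a \<beta> where a: "a \<bullet> (c /\<^sub>R \<rho>) < \<beta>" "\<And>x. x \<in> ?H \<Longrightarrow> \<beta> < a \<bullet> x"
      using separating_hyperplane_closed_point[of ?H "c /\<^sub>R \<rho>"] by auto
    obtain y z where yz: "y \<in> V" "\<And>w. w \<in> V \<Longrightarrow> orthogonal z w" "a = y + z"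
      using orthogonal_subspace_decomp_exists[of V a] V by (metis span_eq_iff)
    \<comment> \<open>The normal is only tested against vectors of \<open>V\<close>, so its component \<open>y\<close> in \<open>V\<close> separates too.\<close>
    have proj: "a \<bullet> w = y \<bullet> w" if "w \<in> V" for w
      using yz(2)[OF that] by (simp add: yz(3) inner_add_left orthogonal_def)
    have \<beta>: "\<beta> < 0"
      using a(2)[of 0] by (simp add: hull_inc)
    have "s \<bullet> (y /\<^sub>R \<beta>) \<le> 1" if "s \<in> S" for s
    proof -
      have "\<beta> < y \<bullet> s"
        using a(2)[of s] proj[of s] that S by (auto simp: hull_inc)
      then show ?thesis
        using \<beta> by (simp add: inner_commute field_simps)
    qed
    then have "c \<bullet> (y /\<^sub>R \<beta>) \<le> \<rho>"
      by (intro implied subspace_scale V yz(1)) auto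
    moreover have "y \<bullet> c < \<beta> * \<rho>"
      using a(1) proj[OF c] pos by (simp add: field_simps)
    ultimately show False
      using \<beta> by (simp add: inner_commute field_simps)
  qed
  then obtain F u where F: "finite F" "F \<subseteq> S" "independent F"
    "\<And>p. p \<in> F \<Longrightarrow> 0 \<le> u p" "sum u F \<le> 1" "(\<Sum>p\<in>F. u p *\<^sub>R p) = c /\<^sub>R \<rho>"
    by (rule convex_hull_insert_0_independent) blast
  have "card F \<le> dim V"
    using F S by (intro independent_card_le_dim) auto
  moreover have "c \<bullet> y \<le> \<rho>" if y: "\<forall>p\<in>F. p \<bullet> y \<le> 1" for y
  proof -
    have "(c /\<^sub>R \<rho>) \<bullet> y = (\<Sum>p\<in>F. u p * (p \<bullet> y))"
      by (simp flip: F(6) add: inner_sum_left)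
    also have "\<dots> \<le> (\<Sum>p\<in>F. u p * 1)"
      using F(4) y by (intro sum_mono mult_left_mono) auto
    also have "\<dots> \<le> 1"
      using F(5) by simp
    finally show ?thesis
      using pos by (simp add: field_simps)
  qed
  ultimately show thesis
    using that F by blast
qed

section \<open>Symmetric matrices\<close>

lemma col_sum_eq_inner: "col_sum A X = A \<bullet> X"
  by (simp add: col_sum_eq_trace_inner inner_eq_trace_inner)

lemma subspace_Sym: "subspace Sym"
  by (auto simp: subspace_def Sym_def transpose_def vec_eq_iff)

lemma Sym_nth: "X \<in> Sym \<Longrightarrow> X $ i $ j = X $ j $ i"
  unfolding Sym_def transpose_def by (metis (mono_tags, lifting) mem_Collect_eq vec_lambda_beta)

text \<open>
  The spanning matrices are indexed by the unordered pairs \<open>{i, j}\<close>, that is, by the sets of one or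
  two indices, which spares ordering the index type.
\<close>

lemma dim_Sym_le: "dim (Sym :: (real^'n^'n) set) \<le> dim_sym TYPE('n::finite)"
proof -
  define I :: "'n set set" where "I = {T. card T = 1} \<union> {T. card T = 2}"
  define M :: "'n set \<Rightarrow> real^'n^'n" where "M T = (\<chi> i j. if T = {i, j} then 1 else 0)" for T
  have pair: "{i, j} \<in> I" for i j :: 'n
    by (cases "i = j") (auto simp: I_def)
  have "Sym \<subseteq> span (M ` I)"
  proof
    fix X :: "real^'n^'n" assume X: "X \<in> Sym"
    \<comment> \<open>By symmetry the entry of \<open>X\<close> is a function of the unordered pair of its indices.\<close>
    define x where "x T = (SOME r. \<exists>i j. T = {i, j} \<and> r = X $ i $ j)" for T
    have x: "x {i, j} = X $ i $ j" for i j
      unfolding x_def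
      by (rule someI2_ex) (auto simp: doubleton_eq_iff Sym_nth[OF X, of i j])
    have "X = (\<Sum>T\<in>I. x T *\<^sub>R M T)"
    proof -
      have "(\<Sum>T\<in>I. x T *\<^sub>R M T) $ i $ j = X $ i $ j" for i j
      proof -
        have "(\<Sum>T\<in>I. x T *\<^sub>R M T) $ i $ j = (\<Sum>T\<in>I. if T = {i, j} then x T else 0)"
          unfolding sum_component by (intro sum.cong) (auto simp: M_def)
        then show ?thesis
          using pair by (simp add: x)
      qed
      then show ?thesis
        by (simp add: vec_eq_iff)
    qed
    also have "\<dots> \<in> span (M ` I)"
      by (intro span_sum span_scale span_base) auto
    finally show "X \<in> span (M ` I)" .
  qed
  then have "dim (Sym :: (real^'n^'n) set) \<le> card (M ` I)"
    by (intro dim_le_card) auto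
  also have "\<dots> \<le> card I"
    by (intro card_image_le) auto
  also have "\<dots> \<le> (CARD('n) choose 1) + (CARD('n) choose 2)"
    using card_Un_le[of "{T :: 'n set. card T = 1}" "{T. card T = 2}"]
      n_subsets[of "UNIV :: 'n set" 1] n_subsets[of "UNIV :: 'n set" 2]
    by (simp add: I_def)
  also have "\<dots> = dim_sym TYPE('n)"
  proof -
    have "CARD('n) + CARD('n) * (CARD('n) - 1) div 2 = CARD('n) * (CARD('n) + 1) div 2"
      by (cases "CARD('n)") (auto simp: algebra_simps)
    then show ?thesis
      by (simp add: dim_sym_def choose_two)
  qed
  finally show ?thesis .
qed

definition outer :: "real^'n \<Rightarrow> real^'n^'n" where
  "outer v = (\<chi> i j. v $ i * v $ j)"

lemma outer_in_Sym: "outer v \<in> Sym"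
  by (auto simp: outer_def Sym_def transpose_def vec_eq_iff)

lemma inner_outer: "outer v \<bullet> X = v \<bullet> (X *v v)"
  by (auto simp: outer_def inner_vec_def matrix_vector_mult_def sum_distrib_left intro!: sum.cong)

lemma continuous_on_outer: "continuous_on T outer"
  unfolding outer_def by (intro continuous_intros)

section \<open>A strictly feasible matrix\<close>

text \<open>
  The strict inequalities on the compact set \<open>\<A>\<close> hold with a uniform gap, which leaves room
  to add a small multiple of the identity.
\<close>

lemma positive_definite_slater_point:
  fixes \<A> :: "(real^'n^'n) set"
  assumes "compact \<A>" and X: "psd X" "\<And>A. A \<in> \<A> \<Longrightarrow> A \<bullet> X < b"
  obtains Z where "Z \<in> Sym" "\<And>A. A \<in> \<A> \<Longrightarrow> A \<bullet> Z < b" "\<And>v. v \<noteq> 0 \<Longrightarrow> 0 < v \<bullet> (Z *v v)"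
proof -
  obtain e where e: "e > 0" "\<And>A. A \<in> \<A> \<Longrightarrow> A \<bullet> (X + e *\<^sub>R mat 1) < b"
  proof (cases "\<A> = {}")
    case True
    then show thesis
      using that[of 1] by simp
  next
    case False
    obtain A1 where A1: "A1 \<in> \<A>" "\<And>A. A \<in> \<A> \<Longrightarrow> A \<bullet> X \<le> A1 \<bullet> X"
      using continuous_attains_sup[OF assms(1) False, of "\<lambda>A. A \<bullet> X"]
        continuous_on_inner[OF continuous_on_id continuous_on_const, of \<A> X] by blast
    obtain B where B: "B > 0" "\<And>A. A \<in> \<A> \<Longrightarrow> norm A \<le> B"
      using compact_imp_bounded[OF assms(1)] unfolding bounded_pos by blast
    define D where "D = B * (norm (mat 1 :: real^'n^'n) + 1)"
    have D: "D > 0"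
      using B by (simp add: D_def add_nonneg_pos)
    have bound: "A \<bullet> mat 1 < D" if "A \<in> \<A>" for A
    proof -
      have "A \<bullet> mat 1 \<le> norm A * norm (mat 1 :: real^'n^'n)"
        by (rule norm_cauchy_schwarz)
      also have "\<dots> \<le> B * norm (mat 1 :: real^'n^'n)"
        using B that by (intro mult_right_mono) auto
      also have "\<dots> < D"
        using B by (simp add: D_def)
      finally show ?thesis .
    qed
    define e where "e = (b - A1 \<bullet> X) / D"
    have e: "e > 0"
      using X(2)[OF A1(1)] D by (simp add: e_def)
    have "A \<bullet> (X + e *\<^sub>R mat 1) < b" if "A \<in> \<A>" for A
    proof -
      have "e * (A \<bullet> mat 1) < e * D"
        using e bound[OF that] by simp
      also have "\<dots> = b - A1 \<bullet> X"
        using D by (simp add: e_def)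
      finally show ?thesis
        using A1(2)[OF that] by (simp add: inner_add_right)
    qed
    with e that show thesis
      by blast
  qed
  show thesis
  proof
    have "mat 1 \<in> Sym"
      by (simp add: Sym_def transpose_mat)
    with X(1) show "X + e *\<^sub>R mat 1 \<in> Sym"
      by (auto simp: psd_def intro!: subspace_add subspace_scale subspace_Sym)
    fix v :: "real^'n" assume "v \<noteq> 0"
    moreover have "v \<bullet> ((X + e *\<^sub>R mat 1) *v v) = v \<bullet> (X *v v) + e * (v \<bullet> v)"
      by (simp add: matrix_vector_mult_add_rdistrib inner_add_right scaleR_matrix_vector_assoc[symmetric])
    ultimately show "0 < v \<bullet> ((X + e *\<^sub>R mat 1) *v v)"
      using X(1) e by (auto simp: psd_def intro: add_nonneg_pos)
  qed (use e in auto)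
qed

section \<open>Exactness of the relaxation\<close>

lemma feasible_subset_relaxed:
  fixes \<A> :: "(real^'n^'n) set"
  assumes "d \<in> tuples \<A> K"
  shows "feasible b \<A> K \<subseteq> relaxed b d"
proof -
  have "fst (d j) \<in> \<A>" "snd (d j) \<in> K" if "j \<in> {1..dim_sym TYPE('n)}" for j
    using assms that by (auto simp: tuples_def dest!: PiE_mem)
  then show ?thesis
    by (auto simp: feasible_def relaxed_def)
qed

lemma quadratic_form_nonneg_of_sphere:
  fixes X :: "real^'n^'n"
  assumes "\<And>u. norm u = 1 \<Longrightarrow> 0 \<le> u \<bullet> (X *v u)"
  shows "0 \<le> v \<bullet> (X *v v)"
proof (cases "v = 0")
  case False
  define u where "u = v /\<^sub>R norm v"
  have "v = norm v *\<^sub>R u" "norm u = 1"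
    using False by (auto simp: u_def)
  then have "v \<bullet> (X *v v) = (norm v)^2 * (u \<bullet> (X *v u))"
    by (metis (no_types, lifting) inner_scaleR_left inner_scaleR_right
        matrix_vector_mult_scaleR mult.assoc power2_eq_square)
  then show ?thesis
    using assms \<open>norm u = 1\<close> by simp
qed auto

text \<open>
  The maximising tuple, obtained by applying \<open>finite_subsystem\<close> to the constraints normalised at
  the positive definite Slater point. Only unit vectors enter the normalisation: there the
  quadratic form of \<open>Z\<close> is bounded away from \<open>0\<close>, so that the normalised constraints form a compact
  set, and by homogeneity they imply the constraints for all other vectors.
\<close>

lemma bound_attained_by_tuple:
  fixes C :: "real^'n^'n"
  assumes C: "C \<in> Sym" and \<A>: "\<A> \<subseteq> Sym" "compact \<A>" "\<A> \<noteq> {}"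
    and slater: "psd X0" "\<And>A. A \<in> \<A> \<Longrightarrow> A \<bullet> X0 < b"
    and y: "\<And>X. X \<in> feasible b \<A> (cball 0 1) \<Longrightarrow> y \<le> C \<bullet> X"
  obtains d where "d \<in> tuples \<A> (cball 0 1)" "\<And>X. X \<in> relaxed b d \<Longrightarrow> y \<le> C \<bullet> X"
proof -
  obtain Z where Z: "Z \<in> Sym" "\<And>A. A \<in> \<A> \<Longrightarrow> A \<bullet> Z < b"
      "\<And>v. v \<noteq> 0 \<Longrightarrow> 0 < v \<bullet> (Z *v v)"
    using positive_definite_slater_point[OF \<A>(2) slater] by blast
  define f where "f A = A /\<^sub>R (b - A \<bullet> Z)" for A
  define g where "g v = - outer v /\<^sub>R (outer v \<bullet> Z)" for v
  define S where "S = f ` \<A> \<union> g ` sphere 0 1"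
  have f_le: "f A \<bullet> (X - Z) \<le> 1 \<longleftrightarrow> A \<bullet> X \<le> b" if "A \<in> \<A>" for A X
  proof -
    have "f A \<bullet> (X - Z) = (A \<bullet> X - A \<bullet> Z) / (b - A \<bullet> Z)"
      by (simp add: f_def inner_diff_right divide_inverse algebra_simps)
    then show ?thesis
      using Z(2)[OF that] by (simp add: pos_divide_le_eq)
  qed
  have outer_pos: "0 < outer v \<bullet> Z" if "norm v = 1" for v
    using Z(3)[of v] that by (force simp: inner_outer)
  have g_le: "g v \<bullet> (X - Z) \<le> 1 \<longleftrightarrow> 0 \<le> v \<bullet> (X *v v)" if "norm v = 1" for v X
  proof -
    have "g v \<bullet> (X - Z) = (outer v \<bullet> Z - outer v \<bullet> X) / (outer v \<bullet> Z)"
      by (simp add: g_def inner_diff_right divide_inverse algebra_simps)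
    then show ?thesis
      using outer_pos[OF that] by (simp add: pos_divide_le_eq inner_outer)
  qed
  have "compact S"
  proof -
    have "continuous_on \<A> f"
      unfolding f_def using Z(2) by (intro continuous_intros) force
    moreover have "continuous_on (sphere 0 1) g"
      unfolding g_def using outer_pos
      by (intro continuous_intros continuous_on_outer) force
    ultimately show ?thesis
      unfolding S_def using \<A>(2) by (intro compact_Un compact_continuous_image) auto
  qed
  moreover have "S \<subseteq> Sym"
    using \<A>(1) outer_in_Sym subspace_Sym
    by (auto simp: S_def f_def g_def intro!: subspace_scale subspace_neg)
  moreover have "0 \<le> C \<bullet> Z - y"
  proof -
    have "0 \<le> v \<bullet> (Z *v v)" for v
      using Z(3)[of v] by (cases "v = 0") auto
    then have "Z \<in> feasible b \<A> (cball 0 1)"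
      using Z(1,2) by (auto simp: feasible_def col_sum_eq_inner less_imp_le)
    then show ?thesis
      using y by simp
  qed
  moreover have "- C \<bullet> Y \<le> C \<bullet> Z - y" if Y: "Y \<in> Sym" "\<forall>s\<in>S. s \<bullet> Y \<le> 1" for Y
  proof -
    have "Z + Y \<in> feasible b \<A> (cball 0 1)"
    proof -
      have "Z + Y \<in> Sym"
        using Z(1) Y(1) by (rule subspace_add[OF subspace_Sym])
      moreover have "A \<bullet> (Z + Y) \<le> b" if "A \<in> \<A>" for A
        using f_le[OF that, of "Z + Y"] Y(2) that by (simp add: S_def)
      moreover have "0 \<le> v \<bullet> ((Z + Y) *v v)" for v
      proof (rule quadratic_form_nonneg_of_sphere)
        show "0 \<le> u \<bullet> ((Z + Y) *v u)" if "norm u = 1" for u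
          using g_le[OF that, of "Z + Y"] Y(2) that by (simp add: S_def)
      qed
      ultimately show ?thesis
        by (auto simp: feasible_def col_sum_eq_inner)
    qed
    then show ?thesis
      using y[of "Z + Y"] by (simp add: inner_add_right)
  qed
  ultimately obtain F where F: "finite F" "F \<subseteq> S" "card F \<le> dim (Sym :: (real^'n^'n) set)"
      and imp: "\<And>Y. \<forall>p\<in>F. p \<bullet> Y \<le> 1 \<Longrightarrow> - C \<bullet> Y \<le> C \<bullet> Z - y"
    using finite_subsystem[OF subspace_Sym, of S "- C" "C \<bullet> Z - y"]
      subspace_neg[OF subspace_Sym C] by blast
  let ?J = "{1..dim_sym TYPE('n)}"
  obtain A0 where A0: "A0 \<in> \<A>"
    using \<A>(3) by blast
  \<comment> \<open>A single normalised constraint is implied by a pair whose other component is a filler: the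
    zero vector, whose constraint is vacuous, or an arbitrary matrix of \<open>\<A>\<close>.\<close>
  have "\<exists>q\<in>\<A> \<times> cball 0 1. \<forall>X. fst q \<bullet> X \<le> b \<and> 0 \<le> snd q \<bullet> (X *v snd q) \<longrightarrow> p \<bullet> (X - Z) \<le> 1"
    if "p \<in> F" for p
  proof -
    from that F(2) consider A where "A \<in> \<A>" "p = f A" | v where "norm v = 1" "p = g v"
      by (auto simp: S_def)
    then show ?thesis
    proof cases
      case 1
      then show ?thesis
        by (intro bexI[of _ "(A, 0)"]) (auto simp: f_le)
    next
      case 2
      then show ?thesis
        using A0 by (intro bexI[of _ "(A0, v)"]) (auto simp: g_le)
    qed
  qed
  then obtain e where e: "\<And>p. p \<in> F \<Longrightarrow> e p \<in> \<A> \<times> cball 0 1"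
      "\<And>p X. \<lbrakk>p \<in> F; fst (e p) \<bullet> X \<le> b; 0 \<le> snd (e p) \<bullet> (X *v snd (e p))\<rbrakk> \<Longrightarrow> p \<bullet> (X - Z) \<le> 1"
    by metis
  obtain h where h: "inj_on h F" "h ` F \<subseteq> ?J"
    using card_le_inj[of F ?J] F(1,3) dim_Sym_le[where 'n='n] by auto
  define d where "d = (\<lambda>j\<in>?J. if j \<in> h ` F then e (inv_into F h j) else (A0, 0))"
  have "d \<in> tuples \<A> (cball 0 1)"
    using e(1) A0 by (auto simp: tuples_def d_def h(1) simp del: mem_cball)
  moreover have "y \<le> C \<bullet> X" if X: "X \<in> relaxed b d" for X
  proof -
    have "p \<bullet> (X - Z) \<le> 1" if "p \<in> F" for p
    proof -
      have hp: "h p \<in> ?J" "d (h p) = e p"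
        using that h by (auto simp: d_def image_subset_iff)
      have "fst (d (h p)) \<bullet> X \<le> b \<and> 0 \<le> snd (d (h p)) \<bullet> (X *v snd (d (h p)))"
        using X hp(1) unfolding relaxed_def col_sum_eq_inner by blast
      then show ?thesis
        using e(2)[OF that] hp(2) by simp
    qed
    then show ?thesis
      using imp[of "X - Z"] by (simp add: inner_diff_right)
  qed
  ultimately show thesis
    using that by blast
qed

theorem theorem2p4:
  fixes C :: "real^'n^'n" and b :: real
    and \<A> :: "(real^'n^'n) set" and K :: "(real^'n) set"
  assumes "C \<in> Sym"
    and "\<A> \<subseteq> Sym" and "compact \<A>"
    and "(top_of_set Sym) interior_of \<A> \<noteq> {}"
    and "K = cball 0 1"
    and "\<exists>X\<in>Sym. psd X \<and> (\<forall>A\<in>\<A>. trace_inner A X < b)"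
    and "\<exists>d\<in>tuples \<A> K. relaxed b d \<noteq> {}"
  shows "\<exists>d\<^sub>0\<in>tuples \<A> K.
           (\<forall>d\<in>tuples \<A> K. relaxed_value C b d \<le> relaxed_value C b d\<^sub>0) \<and>
           opt_value C b \<A> K = relaxed_value C b d\<^sub>0"
proof -
  have below: "relaxed_value C b d \<le> opt_value C b \<A> K" if "d \<in> tuples \<A> K" for d
    unfolding relaxed_value_def opt_value_def
    by (intro INF_superset_mono feasible_subset_relaxed that order_refl)
  obtain X0 where X0: "psd X0" "\<And>A. A \<in> \<A> \<Longrightarrow> A \<bullet> X0 < b"
    using assms(6) by (auto simp: inner_eq_trace_inner)
  have "X0 \<in> feasible b \<A> K"
    using X0 by (auto simp: feasible_def psd_def col_sum_eq_inner less_imp_le)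
  then have "opt_value C b \<A> K \<le> ereal (col_sum C X0)"
    by (auto simp: opt_value_def intro: INF_lower)
  then have not_top: "opt_value C b \<A> K \<noteq> \<infinity>"
    by auto
  have "\<exists>d\<in>tuples \<A> K. opt_value C b \<A> K \<le> relaxed_value C b d"
  proof (cases "opt_value C b \<A> K")
    case (real y)
    have "\<A> \<noteq> {}"
      using assms(4) interior_of_subset by fastforce
    moreover have "y \<le> C \<bullet> X" if "X \<in> feasible b \<A> (cball 0 1)" for X
    proof -
      have "opt_value C b \<A> K \<le> ereal (col_sum C X)"
        unfolding opt_value_def assms(5) using that by (rule INF_lower)
      then show ?thesis
        by (simp add: real col_sum_eq_inner)
    qed
    ultimately obtain d where "d \<in> tuples \<A> K" "\<And>X. X \<in> relaxed b d \<Longrightarrow> y \<le> C \<bullet> X"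
      using bound_attained_by_tuple[OF assms(1-3) _ X0] assms(5) by blast
    then show ?thesis
      by (intro bexI[of _ d]) (auto simp: real relaxed_value_def col_sum_eq_inner intro: INF_greatest)
  next
    case MInf
    then show ?thesis
      using assms(7) by auto
  qed (use not_top in simp)
  then obtain d where d: "d \<in> tuples \<A> K" "opt_value C b \<A> K \<le> relaxed_value C b d"
    by blast
  then have "opt_value C b \<A> K = relaxed_value C b d"
    using below by (intro antisym) auto
  with d(1) below show ?thesis
    by (intro bexI[of _ d]) auto
qed

end
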